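(* Let $L$ and $M$ be frames and let $f\colon L\to M$ be a frame homomorphism. Then there exists a frame homomorphism $\overline{f}\colon \mathsf{S}_b(L)\to \mathsf{S}_b(M)$ with $\overline{f}(\mathfrak{o}_L(a))=\mathfrak{o}_M(f(a))$ for all $a\in L$ if and only if $f$ is locally exact.
   Context: For a frame $L$ with Heyting implication $\to$, a sublocale of $L$ is a subset $S\subseteq L$ closed under arbitrary meets and such that $a\to s\in S$ for all $a\in L$, $s\in S$. The set $\mathsf{S}(L)$ of all sublocales, ordered by inclusion, is a coframe in which meets are intersections and $\bigvee_i S_i=\{\bigwedge N\mid N\subseteq\bigcup_i S_i\}$. For $a\in L$, the closed and open sublocales are $\mathfrak{c}_L(a)=\{b\in L\mid b\ge a\}$ and $\mathfrak{o}_L(a)=\{a\to b\mid b\in L\}$ (subscripts are omitted when clear); they are complements of each other in $\mathsf{S}(L)$. A sublocale is locally closed if it is of the form $\mathfrak{c}(a)\cap\mathfrak{o}(b)$ with $a,b\in L$. The set $\mathsf{S}_b(L)$ of all joins in $\mathsf{S}(L)$ of families of locally closed sublocales, ordered by inclusion, is a complete Boolean algebra (in particular a frame), and $a\mapsto\mathfrak{o}_L(a)$ is a frame homomorphism $L\to\mathsf{S}_b(L)$. Let $\mathsf{LC}(L)=\{(a,b)\in L\times L\mid a\le b,\ b\to a=a\}$, with the partial order $(x,y)\sqsubseteq(a,b)$ iff $x\le a$ and $b\le a\vee y$ (equivalently, $\mathfrak{c}(a)\cap\mathfrak{o}(b)\subseteq\mathfrak{c}(x)\cap\mathfrak{o}(y)$).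 This is a join-semilattice, anti-isomorphic to the poset of locally closed sublocales of $L$ via $(a,b)\mapsto\mathfrak{c}(a)\cap\mathfrak{o}(b)$. For $(a,b)\in L\times L$ put $lc(a,b)=(b\to a,\,(b\to a)\vee b)\in\mathsf{LC}(L)$. In a join-semilattice $S$, a family $\{a_i\}_{i\in I}$ is admissible if its meet exists in $S$ and, for each $b\in S$, the meet $\bigwedge_{i}(b\vee a_i)$ exists and equals $b\vee\bigwedge_i a_i$. (The empty family is allowed.) A map between join-semilattices is admissible if it sends admissible families to admissible families and preserves their meets. A frame homomorphism $f\colon L\to M$ is locally exact if the map $\mathsf{LC}(f)\colon\mathsf{LC}(L)\to\mathsf{LC}(M)$, $\mathsf{LC}(f)(a,b)=lc(f(a),f(b))$, is admissible. *)

theory Defs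
  imports "HOL-Algebra.Lattice"
begin

(* HOL-Algebra reuses these names for operations on order records; the unqualified names
   should keep denoting the type class operations. *)
hide_const (open) Lattice.sup Lattice.inf Order.top Order.bottom

section \<open>Frames and their homomorphisms\<close>

class frame = complete_lattice +
  assumes inf_Sup_distrib: "inf a (Sup B) = Sup (inf a ` B)"

definition heyting :: "'a::frame \<Rightarrow> 'a \<Rightarrow> 'a" (infixr \<open>\<rightharpoonup>\<close> 60)
  where "a \<rightharpoonup> b = Sup {c. inf c a \<le> b}"

lemma le_heyting_iff: "c \<le> (a \<rightharpoonup> b) \<longleftrightarrow> inf c a \<le> b" for a b c :: "'a::frame"
proof
  assume "c \<le> (a \<rightharpoonup> b)"
  then have "inf c a \<le> inf a (a \<rightharpoonup> b)"
    by (simp add: inf.commute le_infI2)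
  also have "\<dots> \<le> b"
    unfolding heyting_def inf_Sup_distrib by (auto intro!: Sup_least simp: inf.commute)
  finally show "inf c a \<le> b" .
next
  assume "inf c a \<le> b"
  then show "c \<le> (a \<rightharpoonup> b)"
    unfolding heyting_def by (auto intro: Sup_upper)
qed

subclass (in frame) distrib_lattice
proof
  have *: "inf x (sup y z) = sup (inf x y) (inf x z)" for x y z
    using inf_Sup_distrib[of x "{y, z}"] by simp
  show "sup x (inf y z) = inf (sup x y) (sup x z)" for x y z
    by (rule distrib_imp1) (rule *)
qed

definition poset_on :: "'a::order set \<Rightarrow> 'a gorder"
  where "poset_on A = \<lparr>carrier = A, eq = (=), le = (\<le>)\<rparr>"

(* A homomorphism between posets that are frames, so joins and meets are those taken inside
   the posets. For subsets of a power set ordered by inclusion these need not be unions and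
   intersections. Finite meets include the empty one, the top element. *)
definition frame_hom :: "'a gorder \<Rightarrow> 'b gorder \<Rightarrow> ('a \<Rightarrow> 'b) \<Rightarrow> bool"
  where "frame_hom P Q f \<longleftrightarrow>
    f \<in> carrier P \<rightarrow> carrier Q \<and>
    (\<forall>A x. A \<subseteq> carrier P \<longrightarrow> is_lub P x A \<longrightarrow> is_lub Q (f x) (f ` A)) \<and>
    (\<forall>A x. A \<subseteq> carrier P \<longrightarrow> finite A \<longrightarrow> is_glb P x A \<longrightarrow> is_glb Q (f x) (f ` A))"

abbreviation frame_order :: "'a::frame gorder"
  where "frame_order \<equiv> poset_on UNIV"

lemma is_lub_frame_order: "is_lub frame_order x A \<longleftrightarrow> x = Sup A" for x :: "'a::frame"
  by (auto simp: poset_on_def least_def Upper_def intro: Sup_upper Sup_least order.antisym)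

lemma is_glb_frame_order: "is_glb frame_order x A \<longleftrightarrow> x = Inf A" for x :: "'a::frame"
  by (auto simp: poset_on_def greatest_def Lower_def intro: Inf_lower Inf_greatest order.antisym)

lemma frame_hom_frame_order:
  fixes f :: "'a::frame \<Rightarrow> 'b::frame"
  shows "frame_hom frame_order frame_order f \<longleftrightarrow>
    (\<forall>A. f (Sup A) = Sup (f ` A)) \<and> f top = top \<and> (\<forall>x y. f (inf x y) = inf (f x) (f y))"
    (is "_ \<longleftrightarrow> ?S \<and> ?T \<and> ?I")
proof -
  have "frame_hom frame_order frame_order f \<longleftrightarrow>
      ?S \<and> (\<forall>A. finite A \<longrightarrow> f (Inf A) = Inf (f ` A))"
    unfolding frame_hom_def is_lub_frame_order is_glb_frame_order
    by (auto simp: poset_on_def)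
  moreover have "f (Inf A) = Inf (f ` A)" if "finite A" ?T ?I for A
    using that(1) by induction (use that in auto)
  moreover have "?T \<and> ?I" if *: "\<forall>A. finite A \<longrightarrow> f (Inf A) = Inf (f ` A)"
    using *[rule_format, of "{}"] *[rule_format, of "{_, _}"] by simp
  ultimately show ?thesis by blast
qed

section \<open>Sublocales\<close>

definition is_sublocale :: "'a::frame set \<Rightarrow> bool"
  where "is_sublocale S \<longleftrightarrow> (\<forall>A\<subseteq>S. Inf A \<in> S) \<and> (\<forall>a. \<forall>s\<in>S. (a \<rightharpoonup> s) \<in> S)"

definition sublocale_Join :: "'a::frame set set \<Rightarrow> 'a set"
  where "sublocale_Join F = {Inf N |N. N \<subseteq> \<Union>F}"

lemma is_sublocale_Join:
  assumes "\<And>S. S \<in> F \<Longrightarrow> is_sublocale S"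
  shows "is_sublocale (sublocale_Join F)"
  unfolding is_sublocale_def
proof safe
  fix A assume A: "A \<subseteq> sublocale_Join F"
  define N where "N = {x \<in> \<Union>F. Inf A \<le> x}"
  have "Inf N \<le> s" if s: "s \<in> A" for s
  proof -
    from s A obtain M where M: "M \<subseteq> \<Union>F" "s = Inf M"
      unfolding sublocale_Join_def by blast
    have "Inf A \<le> x" if "x \<in> M" for x
      using s M(2) that by (meson Inf_lower order.trans)
    then have "M \<subseteq> N"
      using M(1) unfolding N_def by blast
    then show ?thesis
      by (simp add: M(2) Inf_superset_mono)
  qed
  then have "Inf N = Inf A"
    by (intro order.antisym Inf_greatest) (auto simp: N_def)
  moreover have "N \<subseteq> \<Union>F"
    by (auto simp: N_def)
  ultimately show "Inf A \<in> sublocale_Join F"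
    unfolding sublocale_Join_def by (intro CollectI exI[of _ N]) simp
next
  fix a s assume "s \<in> sublocale_Join F"
  then obtain N where N: "N \<subseteq> \<Union>F" "s = Inf N"
    unfolding sublocale_Join_def by blast
  have "c \<le> (a \<rightharpoonup> s) \<longleftrightarrow> c \<le> Inf ((\<rightharpoonup>) a ` N)" for c
    by (simp add: N(2) le_heyting_iff le_Inf_iff)
  then have "(a \<rightharpoonup> s) = Inf ((\<rightharpoonup>) a ` N)"
    by (meson order.antisym order.refl)
  moreover have "(\<rightharpoonup>) a ` N \<subseteq> \<Union>F"
    using N(1) assms unfolding is_sublocale_def by blast
  ultimately show "(a \<rightharpoonup> s) \<in> sublocale_Join F"
    unfolding sublocale_Join_def by blast
qed

lemma sublocale_Join_is_lub:
  assumes "\<And>S. S \<in> F \<Longrightarrow> is_sublocale S"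
  shows "is_lub (poset_on {S. is_sublocale S}) (sublocale_Join F) F"
proof -
  have "S \<subseteq> sublocale_Join F" if "S \<in> F" for S
  proof
    fix x assume "x \<in> S"
    then have "x = Inf {x}" "{x} \<subseteq> \<Union>F"
      using that by auto
    then show "x \<in> sublocale_Join F"
      unfolding sublocale_Join_def by blast
  qed
  moreover have "sublocale_Join F \<subseteq> T" if "is_sublocale T" "\<forall>S\<in>F. S \<subseteq> T" for T
  proof
    fix x assume "x \<in> sublocale_Join F"
    then obtain N where "N \<subseteq> \<Union>F" "x = Inf N"
      unfolding sublocale_Join_def by blast
    moreover have "N \<subseteq> T"
      using \<open>N \<subseteq> \<Union>F\<close> that(2) by blast
    ultimately show "x \<in> T"
      using that(1) unfolding is_sublocale_def by blast
  qed
  ultimately show ?thesis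
    using is_sublocale_Join[OF assms] assms
    by (auto simp: least_def Upper_def poset_on_def)
qed

definition closed_sublocale :: "'a::frame \<Rightarrow> 'a set"
  where "closed_sublocale a = {b. a \<le> b}"

definition open_sublocale :: "'a::frame \<Rightarrow> 'a set"
  where "open_sublocale a = {a \<rightharpoonup> b |b. True}"

definition locally_closed :: "'a::frame set \<Rightarrow> bool"
  where "locally_closed S \<longleftrightarrow> (\<exists>a b. S = closed_sublocale a \<inter> open_sublocale b)"

definition Sb :: "'a::frame set gorder"
  where "Sb = poset_on {sublocale_Join F |F. \<forall>S\<in>F. locally_closed S}"

section \<open>Locally closed pairs\<close>

definition LC :: "('a::frame \<times> 'a) gorder"
  where "LC = \<lparr>carrier = {(a, b). a \<le> b \<and> (b \<rightharpoonup> a) = a}, eq = (=),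
               le = (\<lambda>(x, y) (a, b). x \<le> a \<and> b \<le> sup a y)\<rparr>"

definition lc :: "'a::frame \<times> 'a \<Rightarrow> 'a \<times> 'a"
  where "lc = (\<lambda>(a, b). (b \<rightharpoonup> a, sup (b \<rightharpoonup> a) b))"

lemma lc_in_LC: "lc p \<in> carrier LC"
proof -
  obtain a b where p: "p = (a, b)" by fastforce
  let ?h = "b \<rightharpoonup> a"
  have "c \<le> (sup ?h b \<rightharpoonup> ?h) \<longleftrightarrow> c \<le> ?h" for c
  proof -
    have "inf (inf c (sup ?h b)) b = inf c b"
      by (simp add: inf.assoc inf.absorb2)
    then show ?thesis by (simp add: le_heyting_iff)
  qed
  then have "(sup ?h b \<rightharpoonup> ?h) = ?h"
    by (meson order.antisym order.refl)
  then show ?thesis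
    by (simp add: p lc_def LC_def)
qed

lemma LC_join_is_lub:
  assumes "(a, b) \<in> carrier LC" "(c, d) \<in> carrier LC"
  shows "is_lub LC (lc (sup a c, inf b d)) {(a, b), (c, d)}"
proof -
  let ?p = "sup a c" and ?q = "inf b d"
  let ?h = "?q \<rightharpoonup> ?p"
  have h: "?p \<le> ?h"
    by (simp add: le_heyting_iff)
  have up: "lc (?p, ?q) \<in> Upper LC {(a, b), (c, d)}"
    using lc_in_LC[of "(?p, ?q)"] h
    by (auto simp: Upper_def LC_def lc_def intro: le_supI2 le_infI1 le_infI2)
  have "le LC (lc (?p, ?q)) (e, g)" if "(e, g) \<in> Upper LC {(a, b), (c, d)}" for e g
  proof -
    from that assms have e: "(g \<rightharpoonup> e) = e" "?p \<le> e" "g \<le> sup e b" "g \<le> sup e d"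
      by (auto simp: Upper_def LC_def)
    have g: "g \<le> sup e ?q"
      using e by (simp add: sup_inf_distrib1)
    have "inf ?h g \<le> inf ?h (sup e ?q)"
      using g by (simp add: le_infI2)
    also have "\<dots> = sup (inf ?h e) (inf ?h ?q)"
      by (rule inf_sup_distrib1)
    also have "\<dots> \<le> e"
    proof (rule sup_least)
      have "inf ?h ?q \<le> ?p"
        by (simp add: le_heyting_iff[symmetric])
      then show "inf ?h ?q \<le> e"
        using e(2) by (rule order.trans)
    qed simp
    finally have "inf ?h g \<le> e" .
    then have "?h \<le> e"
      by (simp add: le_heyting_iff[symmetric] e(1))
    moreover have "sup e ?q \<le> sup e (sup ?h ?q)"
      by (simp add: sup.coboundedI2)
    ultimately show ?thesis
      using order.trans[OF g] by (simp add: LC_def lc_def)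
  qed
  then show ?thesis
    using up by (auto simp: least_def Upper_def)
qed

lemma LC_semilattice:
  "partial_order (LC :: ('a::frame \<times> 'a) gorder)"
  "weak_upper_semilattice (LC :: ('a::frame \<times> 'a) gorder)"
proof -
  show part: "partial_order (LC :: ('a \<times> 'a) gorder)"
  proof unfold_locales
    fix x y z :: "'a \<times> 'a"
    obtain a b c d e g where [simp]: "x = (a, b)" "y = (c, d)" "z = (e, g)"
      by (cases x, cases y, cases z) blast
    show "x \<sqsubseteq>\<^bsub>LC\<^esub> x"
      by (simp add: LC_def)
    show "x .=\<^bsub>LC\<^esub> y" if "x \<sqsubseteq>\<^bsub>LC\<^esub> y" "y \<sqsubseteq>\<^bsub>LC\<^esub> x" "x \<in> carrier LC" "y \<in> carrier LC"
      using that by (auto simp: LC_def sup.absorb2 intro: order.antisym)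
    show "x \<sqsubseteq>\<^bsub>LC\<^esub> z" if "x \<sqsubseteq>\<^bsub>LC\<^esub> y" "y \<sqsubseteq>\<^bsub>LC\<^esub> z"
    proof -
      from that have *: "a \<le> c" "c \<le> e" "d \<le> sup c b" "g \<le> sup e d"
        by (simp_all add: LC_def)
      have "sup e d \<le> sup e b"
        using *(2) by (intro sup_least order.trans[OF *(3)]) (auto intro: le_supI1)
      then show ?thesis
        using * by (auto simp: LC_def intro: order.trans)
    qed
  qed (simp_all add: LC_def)
  interpret partial_order "LC :: ('a \<times> 'a) gorder" by (rule part)
  show "weak_upper_semilattice (LC :: ('a \<times> 'a) gorder)"
  proof unfold_locales
    fix x y :: "'a \<times> 'a" assume "x \<in> carrier LC" "y \<in> carrier LC"
    then show "\<exists>s. is_lub LC s {x, y}"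
      using LC_join_is_lub by (cases x, cases y) blast
  qed
qed

definition LC_map :: "('a::frame \<Rightarrow> 'b::frame) \<Rightarrow> 'a \<times> 'a \<Rightarrow> 'b \<times> 'b"
  where "LC_map f = (\<lambda>(a, b). lc (f a, f b))"

section \<open>Admissible families and locally exact homomorphisms\<close>

(* Admissibility of a family only depends on its set of members, so families are given
   as subsets of the carrier. *)
definition admissible_family :: "'a gorder \<Rightarrow> 'a set \<Rightarrow> bool"
  where "admissible_family S A \<longleftrightarrow> A \<subseteq> carrier S \<and>
    (\<exists>m. is_glb S m A \<and> (\<forall>b\<in>carrier S. is_glb S (b \<squnion>\<^bsub>S\<^esub> m) ((\<lambda>a. b \<squnion>\<^bsub>S\<^esub> a) ` A)))"

definition admissible_map :: "'a gorder \<Rightarrow> 'b gorder \<Rightarrow> ('a \<Rightarrow> 'b) \<Rightarrow> bool"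
  where "admissible_map S T f \<longleftrightarrow> f \<in> carrier S \<rightarrow> carrier T \<and>
    (\<forall>A. admissible_family S A \<longrightarrow> admissible_family T (f ` A) \<and>
      (\<forall>m. is_glb S m A \<longrightarrow> is_glb T (f m) (f ` A)))"

definition locally_exact :: "('a::frame \<Rightarrow> 'b::frame) \<Rightarrow> bool"
  where "locally_exact f \<longleftrightarrow> admissible_map LC LC (LC_map f)"

end

theory Submission
  imports Defs
begin

text \<open>
  Sending \<open>(a, b)\<close> to \<open>S(a, b) = c(a) \<inter> o(b)\<close> turns meets in \<open>LC\<close> into joins of locally closed
  sublocales. A family in \<open>LC\<close> is admissible with meet \<open>m\<close> exactly when \<open>S(m)\<close> is the join of the
  corresponding sublocales taken in the coframe of all sublocales: locally closed sublocales are
  complemented, so meeting with them distributes over arbitrary joins; conversely, if \<open>S(m)\<close> is not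
  contained in the join \<open>J\<close>, then it contains a nontrivial locally closed sublocale disjoint from
  \<open>J\<close>, and meeting with it contradicts admissibility. Hence \<open>f\<close> is locally exact iff
  \<open>S(a, b) \<mapsto> S(f a, f b)\<close> preserves those joins of locally closed sublocales that happen to be
  locally closed. This map then extends to \<open>J \<mapsto> \<Squnion>{S(f a, f b) | S(a, b) \<subseteq> J}\<close>; conversely, any
  frame homomorphism extending \<open>f\<close> preserves complements, so it is given by this map on locally
  closed sublocales.
\<close>

section \<open>Locally closed sublocales\<close>

lemma heyting_antimono: "a \<le> b \<Longrightarrow> (b \<rightharpoonup> c) \<le> (a \<rightharpoonup> c)" for a b c :: "'a::frame"
  by (meson inf_mono le_heyting_iff order.refl order.trans)

lemma le_heyting: "b \<le> (a \<rightharpoonup> b)" for a b :: "'a::frame"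
  by (simp add: le_heyting_iff)

lemma heyting_mp: "inf (a \<rightharpoonup> b) a \<le> b" for a b :: "'a::frame"
  by (simp flip: le_heyting_iff)

lemma heyting_heyting: "(a \<rightharpoonup> b \<rightharpoonup> c) = (inf a b \<rightharpoonup> c)" for a b c :: "'a::frame"
  by (rule order.antisym) (metis le_heyting_iff order.refl inf.assoc)+

lemma heyting_Inf: "(a \<rightharpoonup> Inf N) = Inf ((\<rightharpoonup>) a ` N)" for a :: "'a::frame"
proof -
  have "c \<le> (a \<rightharpoonup> Inf N) \<longleftrightarrow> c \<le> Inf ((\<rightharpoonup>) a ` N)" for c
    by (simp add: le_heyting_iff le_Inf_iff)
  then show ?thesis
    by (meson order.antisym order.refl)
qed

text \<open>The operation \<open>b \<rightharpoonup> _\<close> is idempotent, so its image is its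
  set of fixed points.\<close>

lemma mem_open_sublocale_iff: "x \<in> open_sublocale b \<longleftrightarrow> (b \<rightharpoonup> x) = x"
proof
  show "x \<in> open_sublocale b \<Longrightarrow> (b \<rightharpoonup> x) = x"
    by (auto simp: open_sublocale_def heyting_heyting)
  show "(b \<rightharpoonup> x) = x \<Longrightarrow> x \<in> open_sublocale b"
    unfolding open_sublocale_def by (intro CollectI exI[of _ x]) simp
qed

text \<open>Arbitrary pairs are allowed, not only those in \<open>carrier LC\<close>, so that
  intersections and the action of f are computed componentwise without renormalising.\<close>

definition lcs :: "'a::frame \<times> 'a \<Rightarrow> 'a set"
  where "lcs = (\<lambda>(a, b). closed_sublocale a \<inter> open_sublocale b)"

lemma mem_lcs_iff: "x \<in> lcs (a, b) \<longleftrightarrow> a \<le> x \<and> (b \<rightharpoonup> x) = x"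
  by (simp add: lcs_def closed_sublocale_def mem_open_sublocale_iff)

lemma locally_closed_iff: "locally_closed S \<longleftrightarrow> (\<exists>p. S = lcs p)"
  by (auto simp: locally_closed_def lcs_def)

text \<open>The source of elements of \<open>lcs (a, b)\<close>: the operation
  \<open>b \<rightharpoonup> _\<close> retracts \<open>closed_sublocale a\<close> onto it.\<close>

lemma heyting_mem_lcs: "a \<le> x \<Longrightarrow> (b \<rightharpoonup> x) \<in> lcs (a, b)"
  by (auto simp: mem_lcs_iff heyting_heyting intro: order.trans[OF _ le_heyting])

lemma is_sublocale_lcs: "is_sublocale (lcs p)"
proof (cases p)
  case (Pair a b)
  have "(b \<rightharpoonup> Inf A) = Inf A" if "\<And>x. x \<in> A \<Longrightarrow> (b \<rightharpoonup> x) = x" for A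
    using that by (simp add: heyting_Inf)
  moreover have "(b \<rightharpoonup> c \<rightharpoonup> x) = (c \<rightharpoonup> x)" if "(b \<rightharpoonup> x) = x" for c x
    by (metis heyting_heyting inf.commute that)
  ultimately show ?thesis
    by (auto simp: Pair is_sublocale_def mem_lcs_iff subset_iff
        intro!: Inf_greatest intro: order.trans[OF _ le_heyting])
qed

lemma top_mem_sublocale: "is_sublocale S \<Longrightarrow> top \<in> S"
  unfolding is_sublocale_def by (metis Inf_empty empty_subsetI)

lemma top_heyting: "(top \<rightharpoonup> x) = x" for x :: "'a::frame"
  using heyting_mp[of top x] by (intro order.antisym le_heyting) simp

lemma heyting_top: "(a \<rightharpoonup> top) = top" for a :: "'a::frame"
  by (metis le_heyting top_unique)

lemma lcs_bot_top: "lcs (bot, top) = UNIV"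
  by (auto simp: mem_lcs_iff top_heyting)

lemma lcs_top: "lcs (top, b) = {top}"
  by (auto simp: mem_lcs_iff top_unique heyting_top)

lemma lcs_Int: "lcs (a, b) \<inter> lcs (c, d) = lcs (sup a c, inf b d)"
proof -
  have "(b \<rightharpoonup> x) = x \<and> (d \<rightharpoonup> x) = x \<longleftrightarrow> (inf b d \<rightharpoonup> x) = x" for x
    by (metis heyting_heyting inf_le1 inf_le2 heyting_antimono le_heyting order.antisym)
  then have "x \<in> lcs (a, b) \<inter> lcs (c, d) \<longleftrightarrow> x \<in> lcs (sup a c, inf b d)" for x
    unfolding Int_iff mem_lcs_iff le_sup_iff by blast
  then show ?thesis
    by blast
qed

text \<open>The two inequalities express inclusion in \<open>closed_sublocale c\<close> and in
  \<open>open_sublocale d\<close>. Only binary meets and joins occur, so lattice homomorphisms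
  preserve inclusions.\<close>

lemma lcs_subset_iff:
  "lcs (a, b) \<subseteq> lcs (c, d) \<longleftrightarrow> inf b c \<le> a \<and> b \<le> sup a d" (is "?L \<longleftrightarrow> ?R")
proof
  assume L: ?L
  \<comment> \<open>This is the least element of \<open>lcs (a, b)\<close>, so it decides inclusion
    in \<open>closed_sublocale c\<close>.\<close>
  have "(b \<rightharpoonup> a) \<in> lcs (c, d)"
    using L heyting_mem_lcs[of a a b] by auto
  then have 1: "inf b c \<le> a"
    by (simp add: mem_lcs_iff le_heyting_iff inf.commute)
  \<comment> \<open>Chosen so that \<open>d \<rightharpoonup> ?y\<close> is top; membership in
    \<open>open_sublocale d\<close> then forces \<open>?y\<close> itself to be top.\<close>
  let ?y = "b \<rightharpoonup> sup a (inf b d)"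
  have "?y \<in> lcs (c, d)"
    using L heyting_mem_lcs[of a "sup a (inf b d)" b] by auto
  moreover have "top \<le> (d \<rightharpoonup> ?y)"
    by (simp add: heyting_heyting le_heyting_iff inf.commute)
  ultimately have "top \<le> ?y"
    by (simp add: mem_lcs_iff)
  then have "b \<le> sup a (inf b d)"
    by (simp add: le_heyting_iff)
  then show ?R
    using 1 by (simp add: sup_inf_distrib1)
next
  assume R: ?R
  show ?L
  proof
    fix x assume "x \<in> lcs (a, b)"
    then have x: "a \<le> x" "(b \<rightharpoonup> x) = x"
      by (simp_all add: mem_lcs_iff)
    have "c \<le> (b \<rightharpoonup> x)"
      using R x(1) by (auto simp: le_heyting_iff inf.commute)
    moreover have "inf (d \<rightharpoonup> x) (sup a d) \<le> x"
      unfolding inf_sup_distrib1 using heyting_mp[of d x] x(1) by (auto intro: le_infI2)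
    then have "(d \<rightharpoonup> x) \<le> (b \<rightharpoonup> x)"
      using R unfolding le_heyting_iff by (meson inf_mono order.refl order.trans)
    ultimately show "x \<in> lcs (c, d)"
      using x by (simp add: mem_lcs_iff order.antisym le_heyting)
  qed
qed

text \<open>Normalising replaces the lower component by the least element of the sublocale. This
  lets arbitrary pairs stand in for elements of \<open>carrier LC\<close>.\<close>

lemma lcs_lc: "lcs (lc p) = lcs p"
proof (cases p)
  case (Pair a b)
  have "inf (sup (b \<rightharpoonup> a) b) a \<le> (b \<rightharpoonup> a)" "inf b (b \<rightharpoonup> a) \<le> a"
    using heyting_mp[of b a] le_infI2[OF le_heyting] by (simp_all add: inf.commute[of b])
  then show ?thesis
    unfolding Pair lc_def prod.case by (intro equalityI) (simp_all add: lcs_subset_iff le_heyting le_supI1 le_supI2)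
qed

section \<open>Joins of sublocales\<close>

lemma subset_sublocale_Join: "S \<in> F \<Longrightarrow> S \<subseteq> sublocale_Join F"
proof
  fix x assume "S \<in> F" "x \<in> S"
  then have "x = Inf {x}" "{x} \<subseteq> \<Union>F"
    by auto
  then show "x \<in> sublocale_Join F"
    unfolding sublocale_Join_def by blast
qed

lemma sublocale_Join_subset:
  assumes "is_sublocale T" "\<And>S. S \<in> F \<Longrightarrow> S \<subseteq> T"
  shows "sublocale_Join F \<subseteq> T"
  using assms unfolding sublocale_Join_def is_sublocale_def by blast

text \<open>If x = Inf N is fixed by \<open>b \<rightharpoonup> _\<close>, then x is also the meet
  of all \<open>b \<rightharpoonup> n\<close>. Each of these stays in the same member of F as n and
  lies in \<open>lcs p\<close>, because a \<le> x \<le> n.\<close>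

lemma lcs_Int_sublocale_Join:
  assumes F: "\<And>S. S \<in> F \<Longrightarrow> is_sublocale S"
  shows "lcs p \<inter> sublocale_Join F \<subseteq> sublocale_Join ((\<inter>) (lcs p) ` F)"
proof
  fix x assume x: "x \<in> lcs p \<inter> sublocale_Join F"
  obtain a b where p: "p = (a, b)"
    by fastforce
  from x obtain N where N: "N \<subseteq> \<Union>F" "x = Inf N"
    unfolding sublocale_Join_def by blast
  have x': "a \<le> x" "(b \<rightharpoonup> x) = x"
    using x by (simp_all add: p mem_lcs_iff)
  have "(b \<rightharpoonup> n) \<in> \<Union>((\<inter>) (lcs p) ` F)" if n: "n \<in> N" for n
  proof -
    have "a \<le> n"
      using x'(1) n N(2) by (meson Inf_lower order.trans)
    then have "(b \<rightharpoonup> n) \<in> lcs p"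
      unfolding p by (rule heyting_mem_lcs)
    moreover obtain S where "S \<in> F" "(b \<rightharpoonup> n) \<in> S"
      using n N(1) F unfolding is_sublocale_def by blast
    ultimately show ?thesis
      by blast
  qed
  moreover have "x = Inf ((\<rightharpoonup>) b ` N)"
    using x'(2) by (simp add: N(2) heyting_Inf)
  ultimately show "x \<in> sublocale_Join ((\<inter>) (lcs p) ` F)"
    unfolding sublocale_Join_def by blast
qed

text \<open>Cuts a cover of \<open>lcs p\<close> down to pieces inside \<open>lcs p\<close>.\<close>

lemma lcs_eq_sublocale_Join_Int:
  assumes "\<And>S. S \<in> F \<Longrightarrow> is_sublocale S" "lcs p \<subseteq> sublocale_Join F"
  shows "lcs p = sublocale_Join ((\<inter>) (lcs p) ` F)"
proof
  show "lcs p \<subseteq> sublocale_Join ((\<inter>) (lcs p) ` F)"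
    using lcs_Int_sublocale_Join[OF assms(1)] assms(2) by blast
  show "sublocale_Join ((\<inter>) (lcs p) ` F) \<subseteq> lcs p"
    by (rule sublocale_Join_subset) (auto simp: is_sublocale_lcs)
qed

lemma is_sublocale_Join_lcs: "is_sublocale (sublocale_Join (lcs ` A))"
  by (rule is_sublocale_Join) (auto simp: is_sublocale_lcs)

text \<open>The test sublocale is \<open>c(x) \<inter> o(y)\<close>, cut down to \<open>lcs p\<close>, where \<open>x \<in> lcs p - J\<close> and \<open>y\<close> is the
  least element of \<open>J\<close> above \<open>x\<close>.\<close>
lemma lcs_subset_sublocaleI:
  assumes J: "is_sublocale J"
    and triv: "\<And>q. lcs q \<subseteq> lcs p \<Longrightarrow> lcs q \<inter> J \<subseteq> {top} \<Longrightarrow> lcs q \<subseteq> {top}"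
  shows "lcs p \<subseteq> J"
proof
  fix x assume x: "x \<in> lcs p"
  obtain a b where p: "p = (a, b)"
    by fastforce
  define y where "y = Inf {z \<in> J. x \<le> z}"
  have y: "y \<in> J" "x \<le> y"
    using J unfolding y_def is_sublocale_def by (auto intro: Inf_greatest)
  define q where "q = (sup x a, inf y b)"
  have q: "lcs q = lcs (x, y) \<inter> lcs p"
    by (simp add: q_def p lcs_Int)
  have "z = top" if "z \<in> J" "x \<le> z" "(y \<rightharpoonup> z) = z" for z
  proof -
    have "y \<le> z"
      unfolding y_def using that by (simp add: Inf_lower)
    then have "top \<le> (y \<rightharpoonup> z)"
      by (simp add: le_heyting_iff)
    then show ?thesis
      by (simp add: that(3) top_unique)
  qed
  then have "lcs q \<inter> J \<subseteq> {top}"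
    by (auto simp: q mem_lcs_iff)
  then have "lcs q \<subseteq> {top}"
    using triv q by blast
  \<comment> \<open>This element is top only if y \<le> x, and then x equals y, which lies in
    J.\<close>
  moreover have "(y \<rightharpoonup> x) \<in> lcs q"
    using x is_sublocale_lcs[of p] heyting_mem_lcs[of x x y] by (simp add: q is_sublocale_def)
  ultimately have "(y \<rightharpoonup> x) = top"
    by blast
  then have "y \<le> x"
    by (metis heyting_mp inf_top_left)
  then show "x \<in> J"
    using y by (metis order.antisym)
qed

section \<open>Admissible families of locally closed pairs\<close>

text \<open>Only the larger pair has to be normalised: for p = (x, y) and q = (a, b), the equation
  \<open>(b \<rightharpoonup> a) = a\<close> turns the condition \<open>inf b x \<le> a\<close> of
  \<open>lcs_subset_iff\<close> into x \<le> a.\<close>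

lemma LC_le_iff: "q \<in> carrier LC \<Longrightarrow> p \<sqsubseteq>\<^bsub>LC\<^esub> q \<longleftrightarrow> lcs q \<subseteq> lcs p"
  by (cases p, cases q) (auto simp: LC_def lcs_subset_iff inf.commute simp flip: le_heyting_iff)

text \<open>The competitor p ranges over all pairs, since \<open>lc p\<close> represents the same
  sublocale inside \<open>carrier LC\<close>.\<close>

lemma is_glb_LC_iff:
  assumes "A \<subseteq> carrier LC"
  shows "is_glb LC m A \<longleftrightarrow> m \<in> carrier LC \<and> (\<forall>a\<in>A. lcs a \<subseteq> lcs m) \<and>
    (\<forall>p. (\<forall>a\<in>A. lcs a \<subseteq> lcs p) \<longrightarrow> lcs m \<subseteq> lcs p)"
    (is "_ \<longleftrightarrow> ?R")
proof
  assume glb: "is_glb LC m A"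
  then have m: "m \<in> carrier LC" "m \<in> Lower LC A"
    by (auto simp: greatest_def Lower_def)
  have "lcs m \<subseteq> lcs p" if "\<forall>a\<in>A. lcs a \<subseteq> lcs p" for p
  proof -
    have "lc p \<in> Lower LC A"
      using that assms by (auto simp: Lower_def LC_le_iff lc_in_LC lcs_lc)
    then have "lc p \<sqsubseteq>\<^bsub>LC\<^esub> m"
      using glb by (simp add: greatest_def)
    then show ?thesis
      using m by (simp add: LC_le_iff lcs_lc)
  qed
  moreover have "lcs a \<subseteq> lcs m" if "a \<in> A" for a
    using that m assms LC_le_iff[of a m] unfolding Lower_def by blast
  ultimately show ?R
    using m by blast
next
  assume R: ?R
  have "p \<sqsubseteq>\<^bsub>LC\<^esub> m" if "p \<in> Lower LC A" for p
  proof -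
    have "\<forall>a\<in>A. lcs a \<subseteq> lcs p"
      using that assms LC_le_iff[of _ p] unfolding Lower_def by blast
    then show ?thesis
      using R LC_le_iff[of m p] by blast
  qed
  moreover have "m \<in> Lower LC A"
    using R assms LC_le_iff[of _ m] unfolding Lower_def by blast
  ultimately show "is_glb LC m A"
    by (auto simp: greatest_def Lower_def)
qed

lemma is_glb_LC_unique: "is_glb LC m A \<Longrightarrow> is_glb LC n A \<Longrightarrow> m = n"
  using partial_order.greatest_unique[OF LC_semilattice(1)] by blast

lemma LC_join:
  assumes "p \<in> carrier LC" "q \<in> carrier LC"
  shows "p \<squnion>\<^bsub>LC\<^esub> q \<in> carrier LC" "lcs (p \<squnion>\<^bsub>LC\<^esub> q) = lcs p \<inter> lcs q"
proof -
  obtain a b c d where [simp]: "p = (a, b)" "q = (c, d)"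
    by (cases p, cases q) blast
  have lub: "is_lub LC (lc (sup a c, inf b d)) {p, q}"
    using assms LC_join_is_lub by auto
  \<comment> \<open>The join operation chooses some least upper bound; antisymmetry identifies it
    with the explicit one.\<close>
  then have "is_lub LC (p \<squnion>\<^bsub>LC\<^esub> q) {p, q}"
    unfolding join_def sup_def by (rule someI)
  then have "p \<squnion>\<^bsub>LC\<^esub> q = lc (sup a c, inf b d)"
    using lub partial_order.least_unique[OF LC_semilattice(1)] by blast
  then show "p \<squnion>\<^bsub>LC\<^esub> q \<in> carrier LC" "lcs (p \<squnion>\<^bsub>LC\<^esub> q) = lcs p \<inter> lcs q"
    by (simp_all add: lc_in_LC lcs_lc lcs_Int)
qed

text \<open>The join is least among all sublocales containing the members, hence among the locally
  closed ones. The converse below uses admissibility.\<close>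

lemma is_glb_LC_if_sublocale_Join:
  assumes "A \<subseteq> carrier LC" "m \<in> carrier LC" "lcs m = sublocale_Join (lcs ` A)"
  shows "is_glb LC m A"
  unfolding is_glb_LC_iff[OF assms(1)] assms(3)
  by (intro conjI ballI allI impI assms(2) subset_sublocale_Join
      sublocale_Join_subset[OF is_sublocale_lcs]) auto

lemma lcs_eq_sublocale_Join_if_admissible:
  assumes A: "admissible_family LC A" and m: "is_glb LC m A"
  shows "lcs m = sublocale_Join (lcs ` A)" (is "_ = ?J")
proof
  from A have sub: "A \<subseteq> carrier LC"
    by (simp add: admissible_family_def)
  have mLC: "m \<in> carrier LC" and upper: "\<And>a. a \<in> A \<Longrightarrow> lcs a \<subseteq> lcs m"
    using m sub by (auto simp: is_glb_LC_iff)
  show "?J \<subseteq> lcs m"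
    using upper by (intro sublocale_Join_subset is_sublocale_lcs) auto
  show "lcs m \<subseteq> ?J"
  proof (rule lcs_subset_sublocaleI[OF is_sublocale_Join_lcs])
    fix q assume q: "lcs q \<subseteq> lcs m" "lcs q \<inter> ?J \<subseteq> {top}"
    let ?q = "lc q"
    \<comment> \<open>Admissibility supplies a meet of its own, which uniqueness identifies with
      m.\<close>
    have dist: "is_glb LC (?q \<squnion>\<^bsub>LC\<^esub> m) ((\<lambda>a. ?q \<squnion>\<^bsub>LC\<^esub> a) ` A)"
      using A m lc_in_LC is_glb_LC_unique unfolding admissible_family_def by metis
    have join: "lcs (?q \<squnion>\<^bsub>LC\<^esub> a) = lcs q \<inter> lcs a" "?q \<squnion>\<^bsub>LC\<^esub> a \<in> carrier LC"
      if "a \<in> carrier LC" for a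
      using LC_join[OF lc_in_LC that, of q] by (simp_all add: lcs_lc)
    \<comment> \<open>The pair \<open>(top, top)\<close> represents the least sublocale, so this
      bounds every \<open>?q \<squnion> a\<close> by the trivial sublocale, and \<open>dist\<close>
      carries the bound over to \<open>?q \<squnion> m\<close>.\<close>
    have "lcs (?q \<squnion>\<^bsub>LC\<^esub> a) \<subseteq> lcs (top, top)" if "a \<in> A" for a
    proof -
      have "lcs (?q \<squnion>\<^bsub>LC\<^esub> a) = lcs q \<inter> lcs a"
        using that sub by (intro join) blast
      then show ?thesis
        using that q(2) subset_sublocale_Join[of "lcs a" "lcs ` A"] by (auto simp: lcs_top)
    qed
    moreover have "(\<lambda>a. ?q \<squnion>\<^bsub>LC\<^esub> a) ` A \<subseteq> carrier LC"
      using join sub by auto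
    ultimately have "lcs (?q \<squnion>\<^bsub>LC\<^esub> m) \<subseteq> lcs (top, top)"
      using dist by (simp add: is_glb_LC_iff)
    then show "lcs q \<subseteq> {top}"
      using q(1) by (auto simp: join mLC lcs_top)
  qed
qed

text \<open>Both the meet m and its translates by b are recognised as joins of sublocales; for the
  translates this is distributivity, \<open>lcs_Int_sublocale_Join\<close>.\<close>

lemma admissible_family_LC_if_sublocale_Join:
  assumes A: "A \<subseteq> carrier LC" and m: "m \<in> carrier LC" "lcs m = sublocale_Join (lcs ` A)"
  shows "admissible_family LC A"
  unfolding admissible_family_def
proof (intro conjI exI[of _ m] ballI A is_glb_LC_if_sublocale_Join m)
  fix b :: "'a \<times> 'a" assume b: "b \<in> carrier LC"
  show "(\<lambda>a. b \<squnion>\<^bsub>LC\<^esub> a) ` A \<subseteq> carrier LC" "b \<squnion>\<^bsub>LC\<^esub> m \<in> carrier LC"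
    using A m(1) LC_join(1)[OF b] by blast+
  have J: "lcs ` (\<lambda>a. b \<squnion>\<^bsub>LC\<^esub> a) ` A = (\<inter>) (lcs b) ` lcs ` A"
    unfolding image_image using A b by (intro image_cong refl) (auto simp: LC_join)
  have "sublocale_Join ((\<inter>) (lcs b) ` lcs ` A) \<subseteq> lcs (b \<squnion>\<^bsub>LC\<^esub> m)"
    using subset_sublocale_Join[of _ "lcs ` A"] b
    by (intro sublocale_Join_subset is_sublocale_lcs) (auto simp: LC_join b m)
  moreover have "lcs (b \<squnion>\<^bsub>LC\<^esub> m) \<subseteq> sublocale_Join ((\<inter>) (lcs b) ` lcs ` A)"
    unfolding LC_join(2)[OF b m(1)] m(2)
    by (rule lcs_Int_sublocale_Join) (auto simp: is_sublocale_lcs)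
  ultimately show "lcs (b \<squnion>\<^bsub>LC\<^esub> m) = sublocale_Join (lcs ` (\<lambda>a. b \<squnion>\<^bsub>LC\<^esub> a) ` A)"
    unfolding J by blast
qed

section \<open>Local exactness in terms of sublocales\<close>

lemma LC_map_eq: "LC_map f p = lc (map_prod f f p)"
  by (cases p) (simp add: LC_map_def)

lemma lattice_hom_mono:
  fixes f :: "'a::lattice \<Rightarrow> 'b::lattice"
  assumes "\<And>x y. f (inf x y) = inf (f x) (f y)" "x \<le> y"
  shows "f x \<le> f y"
  by (metis assms inf.absorb_iff1)

text \<open>In particular the image sublocale depends on \<open>lcs p\<close> only, not on the
  representing pair.\<close>

lemma lcs_map_mono:
  fixes f :: "'a::frame \<Rightarrow> 'b::frame"
  assumes f: "\<And>x y. f (inf x y) = inf (f x) (f y)" "\<And>x y. f (sup x y) = sup (f x) (f y)"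
    and sub: "lcs p \<subseteq> lcs q"
  shows "lcs (map_prod f f p) \<subseteq> lcs (map_prod f f q)"
proof -
  have "f x \<le> f y" if "x \<le> y" for x y
    using f(1) that by (rule lattice_hom_mono)
  then show ?thesis
    using sub by (cases p, cases q) (simp add: lcs_subset_iff flip: f)
qed

text \<open>Admissible families with their meets are exactly the joins of locally closed sublocales
  that are locally closed, so \<open>LC\<close> and its order disappear from the condition.\<close>

lemma locally_exact_iff:
  fixes f :: "'a::frame \<Rightarrow> 'b::frame"
  assumes f: "\<And>x y. f (inf x y) = inf (f x) (f y)" "\<And>x y. f (sup x y) = sup (f x) (f y)"
  shows "locally_exact f \<longleftrightarrow> (\<forall>A m. lcs m = sublocale_Join (lcs ` A) \<longrightarrow>
    lcs (map_prod f f m) = sublocale_Join (lcs ` map_prod f f ` A))"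
    (is "_ \<longleftrightarrow> ?R")
proof
  assume ex: "locally_exact f"
  show ?R
  proof (intro allI impI)
    fix A and m :: "'a \<times> 'a" assume m: "lcs m = sublocale_Join (lcs ` A)"
    have A: "lc ` A \<subseteq> carrier LC"
      by (auto simp: lc_in_LC)
    have lcA: "lcs (lc m) = sublocale_Join (lcs ` lc ` A)"
      by (simp add: image_image lcs_lc m)
    have "admissible_family LC (lc ` A)" "is_glb LC (lc m) (lc ` A)"
      using admissible_family_LC_if_sublocale_Join[OF A lc_in_LC lcA]
        is_glb_LC_if_sublocale_Join[OF A lc_in_LC lcA] by auto
    then have "lcs (LC_map f (lc m)) = sublocale_Join (lcs ` LC_map f ` lc ` A)"
      using ex unfolding locally_exact_def admissible_map_def
      by (intro lcs_eq_sublocale_Join_if_admissible) blast+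
    \<comment> \<open>The pairs p and \<open>lc p\<close> represent the same sublocale, so
      monotonicity in both directions applies.\<close>
    moreover have "lcs (LC_map f (lc p)) = lcs (map_prod f f p)" for p
      unfolding LC_map_eq lcs_lc
      by (intro equalityI lcs_map_mono[OF f]) (simp_all add: lcs_lc)
    ultimately show "lcs (map_prod f f m) = sublocale_Join (lcs ` map_prod f f ` A)"
      by (simp add: image_image)
  qed
next
  assume R: ?R
  show "locally_exact f"
    unfolding locally_exact_def admissible_map_def
  proof (intro conjI allI impI)
    show "LC_map f \<in> carrier LC \<rightarrow> carrier LC"
      by (auto simp: LC_map_eq lc_in_LC)
    fix A :: "('a \<times> 'a) set" assume A: "admissible_family LC A"
    have sub: "LC_map f ` A \<subseteq> carrier LC"
      by (auto simp: LC_map_eq lc_in_LC)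
    have J: "lcs (LC_map f m) = sublocale_Join (lcs ` LC_map f ` A)" if "is_glb LC m A" for m
    proof -
      have "lcs (map_prod f f m) = sublocale_Join (lcs ` map_prod f f ` A)"
        using R lcs_eq_sublocale_Join_if_admissible[OF A that] by blast
      then show ?thesis
        by (simp add: LC_map_eq lcs_lc image_image)
    qed
    have LCm: "LC_map f m \<in> carrier LC" for m
      by (simp add: LC_map_eq lc_in_LC)
    show "is_glb LC (LC_map f m) (LC_map f ` A)" if "is_glb LC m A" for m
      using is_glb_LC_if_sublocale_Join[OF sub LCm J[OF that]] .
    from A obtain m where "is_glb LC m A"
      unfolding admissible_family_def by blast
    then show "admissible_family LC (LC_map f ` A)"
      using admissible_family_LC_if_sublocale_Join[OF sub LCm J] by blast
  qed
qed

section \<open>The frame of joins of locally closed sublocales\<close>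

lemma sublocale_Join_lcs_in_Sb: "sublocale_Join (lcs ` A) \<in> carrier Sb"
proof -
  have "\<forall>S\<in>lcs ` A. locally_closed S"
    by (auto simp only: locally_closed_iff)
  then show ?thesis
    unfolding Sb_def poset_on_def by auto
qed

lemma lcs_in_Sb: "lcs p \<in> carrier Sb"
proof -
  have "sublocale_Join (lcs ` {p}) = lcs p"
    by (intro equalityI sublocale_Join_subset subset_sublocale_Join) (auto simp: is_sublocale_lcs)
  then show ?thesis
    by (metis sublocale_Join_lcs_in_Sb)
qed

text \<open>Replaces an unknown generating family by the canonical one, consisting of everything
  locally closed below X.\<close>

lemma Sb_eq_sublocale_Join:
  assumes "X \<in> carrier Sb"
  shows "X = sublocale_Join (lcs ` {p. lcs p \<subseteq> X})"
proof -
  from assms obtain F where F: "X = sublocale_Join F" "\<forall>S\<in>F. locally_closed S"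
    by (auto simp: Sb_def poset_on_def)
  have "is_sublocale X"
    unfolding F(1) using F(2) by (intro is_sublocale_Join) (auto simp: locally_closed_iff is_sublocale_lcs)
  moreover have "S \<subseteq> sublocale_Join (lcs ` {p. lcs p \<subseteq> X})" if "S \<in> F" for S
    using that F by (intro subset_sublocale_Join) (auto simp: locally_closed_iff subset_sublocale_Join)
  ultimately show ?thesis
    unfolding F(1)
    by (intro equalityI sublocale_Join_subset[OF is_sublocale_Join_lcs]
        sublocale_Join_subset[of "sublocale_Join F"]) auto
qed

lemma is_sublocale_Sb: "X \<in> carrier Sb \<Longrightarrow> is_sublocale X"
  by (metis Sb_eq_sublocale_Join is_sublocale_Join_lcs)

lemma Sb_subsetI:
  assumes "X \<in> carrier Sb" "is_sublocale Y" "\<And>p. lcs p \<subseteq> X \<Longrightarrow> lcs p \<subseteq> Y"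
  shows "X \<subseteq> Y"
proof -
  have "sublocale_Join (lcs ` {p. lcs p \<subseteq> X}) \<subseteq> Y"
    using assms(3) by (intro sublocale_Join_subset assms(2)) auto
  then show ?thesis
    using Sb_eq_sublocale_Join[OF assms(1)] by simp
qed

lemma sublocale_Join_in_Sb:
  assumes "A \<subseteq> carrier Sb"
  shows "sublocale_Join A \<in> carrier Sb"
proof -
  let ?P = "{p. \<exists>X\<in>A. lcs p \<subseteq> X}"
  have sub: "\<And>X. X \<in> A \<Longrightarrow> is_sublocale X"
    using assms is_sublocale_Sb by blast
  have "sublocale_Join A = sublocale_Join (lcs ` ?P)"
  proof (intro equalityI sublocale_Join_subset is_sublocale_Join_lcs is_sublocale_Join sub)
    fix X assume X: "X \<in> A"
    show "X \<subseteq> sublocale_Join (lcs ` ?P)"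
    proof (rule Sb_subsetI[OF _ is_sublocale_Join_lcs])
      show "X \<in> carrier Sb"
        using X assms by blast
      show "lcs p \<subseteq> sublocale_Join (lcs ` ?P)" if "lcs p \<subseteq> X" for p
        using that X by (intro subset_sublocale_Join) blast
    qed
  next
    fix S assume "S \<in> lcs ` ?P"
    then show "S \<subseteq> sublocale_Join A"
      using subset_sublocale_Join[of _ A] by blast
  qed
  then show ?thesis
    by (simp add: sublocale_Join_lcs_in_Sb)
qed

section \<open>Joins and meets inside \<open>Sb\<close>\<close>

lemma is_lub_poset_on_iff:
  assumes "A \<subseteq> C"
  shows "is_lub (poset_on C) x A \<longleftrightarrow>
    x \<in> C \<and> (\<forall>a\<in>A. a \<le> x) \<and> (\<forall>y\<in>C. (\<forall>a\<in>A. a \<le> y) \<longrightarrow> x \<le> y)"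
proof -
  have "Upper (poset_on C) A = {y \<in> C. \<forall>a\<in>A. a \<le> y}"
    using assms by (auto simp: Upper_def poset_on_def)
  then show ?thesis
    by (simp add: least_def) (auto simp: poset_on_def)
qed

lemma is_glb_poset_on_iff:
  assumes "A \<subseteq> C"
  shows "is_glb (poset_on C) x A \<longleftrightarrow>
    x \<in> C \<and> (\<forall>a\<in>A. x \<le> a) \<and> (\<forall>y\<in>C. (\<forall>a\<in>A. y \<le> a) \<longrightarrow> y \<le> x)"
proof -
  have "Lower (poset_on C) A = {y \<in> C. \<forall>a\<in>A. y \<le> a}"
    using assms by (auto simp: Lower_def poset_on_def)
  then show ?thesis
    by (simp add: greatest_def) (auto simp: poset_on_def)
qed

lemma poset_on_carrier_Sb: "poset_on (carrier Sb) = Sb"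
  by (simp add: Sb_def poset_on_def)

lemma is_lub_Sb_iff:
  assumes A: "A \<subseteq> carrier Sb"
  shows "is_lub Sb X A \<longleftrightarrow> X = sublocale_Join A"
proof
  have "sublocale_Join A \<subseteq> Y" if "Y \<in> carrier Sb" "\<forall>X\<in>A. X \<subseteq> Y" for Y
    using that by (intro sublocale_Join_subset is_sublocale_Sb) auto
  then have lub: "is_lub Sb (sublocale_Join A) A"
    using sublocale_Join_in_Sb[OF A] subset_sublocale_Join[of _ A]
    unfolding is_lub_poset_on_iff[OF A, unfolded poset_on_carrier_Sb] by blast
  then show "X = sublocale_Join A \<Longrightarrow> is_lub Sb X A"
    by simp
  assume "is_lub Sb X A"
  with lub show "X = sublocale_Join A"
    unfolding is_lub_poset_on_iff[OF A, unfolded poset_on_carrier_Sb] by (meson subset_antisym)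
qed

text \<open>Meets in \<open>Sb\<close> need not be intersections, but locally closed sublocales
  generate \<open>Sb\<close>, so they suffice as test objects.\<close>

lemma is_glb_Sb_iff:
  assumes A: "A \<subseteq> carrier Sb"
  shows "is_glb Sb X A \<longleftrightarrow> X \<in> carrier Sb \<and> (\<forall>Y\<in>A. X \<subseteq> Y) \<and>
    (\<forall>p. (\<forall>Y\<in>A. lcs p \<subseteq> Y) \<longrightarrow> lcs p \<subseteq> X)"
proof -
  have "(\<forall>Z\<in>carrier Sb. (\<forall>Y\<in>A. Z \<subseteq> Y) \<longrightarrow> Z \<subseteq> X) \<longleftrightarrow> (\<forall>p. (\<forall>Y\<in>A. lcs p \<subseteq> Y) \<longrightarrow> lcs p \<subseteq> X)"
    if X: "X \<in> carrier Sb"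
  proof (intro iffI allI ballI impI)
    fix Z assume p: "\<forall>p. (\<forall>Y\<in>A. lcs p \<subseteq> Y) \<longrightarrow> lcs p \<subseteq> X" and Z: "Z \<in> carrier Sb" "\<forall>Y\<in>A. Z \<subseteq> Y"
    have "lcs p \<subseteq> X" if "lcs p \<subseteq> Z" for p
      using p Z(2) that subset_trans by metis
    then show "Z \<subseteq> X"
      by (rule Sb_subsetI[OF Z(1) is_sublocale_Sb[OF X]])
  qed (simp add: lcs_in_Sb)
  then show ?thesis
    unfolding is_glb_poset_on_iff[OF A, unfolded poset_on_carrier_Sb] by (intro conj_cong refl)
qed

section \<open>Complements of open sublocales\<close>

lemma open_sublocale_eq_lcs: "open_sublocale b = lcs (bot, b)"
  by (auto simp: mem_lcs_iff mem_open_sublocale_iff)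

lemma closed_sublocale_eq_lcs: "closed_sublocale a = lcs (a, top)"
  using lcs_bot_top by (auto simp: mem_lcs_iff closed_sublocale_def)

lemma Int_lcs_is_glb: "is_glb Sb (lcs p \<inter> lcs q) {lcs p, lcs q}"
proof -
  have "lcs p \<inter> lcs q \<in> carrier Sb"
    by (cases p, cases q) (simp add: lcs_Int lcs_in_Sb)
  then show ?thesis
    by (auto simp: is_glb_Sb_iff lcs_in_Sb)
qed

lemma closed_Int_open: "lcs (a, top) \<inter> lcs (bot, a) = {top}"
proof -
  have "lcs (a, top) \<inter> lcs (bot, a) \<subseteq> lcs (top, top)"
    by (simp add: lcs_Int lcs_subset_iff)
  then show ?thesis
    using top_mem_sublocale[OF is_sublocale_lcs] by (auto simp: lcs_top)
qed

text \<open>Every x is the meet of \<open>a \<rightharpoonup> x\<close>, from the open part, and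
  \<open>sup x a\<close>, from the closed part.\<close>

lemma closed_Join_open: "sublocale_Join {lcs (a, top), lcs (bot, a)} = UNIV"
proof -
  let ?J = "sublocale_Join {lcs (a, top), lcs (bot, a)}"
  have J: "is_sublocale ?J"
    by (rule is_sublocale_Join) (auto simp: is_sublocale_lcs)
  have "x \<in> ?J" for x
  proof -
    have "(a \<rightharpoonup> x) \<in> lcs (bot, a)" "sup x a \<in> lcs (a, top)"
      using heyting_mem_lcs[of bot x a]
      by (auto simp: closed_sublocale_eq_lcs[symmetric] closed_sublocale_def)
    then have "(a \<rightharpoonup> x) \<in> ?J" "sup x a \<in> ?J"
      using subset_sublocale_Join[of _ "{lcs (a, top), lcs (bot, a)}"] by blast+
    then have "{a \<rightharpoonup> x, sup x a} \<subseteq> ?J"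
      by simp
    then have "Inf {a \<rightharpoonup> x, sup x a} \<in> ?J"
      using J unfolding is_sublocale_def by metis
    moreover have "inf (a \<rightharpoonup> x) (sup x a) = x"
      using heyting_mp[of a x] le_heyting[of x a] by (simp add: inf_sup_distrib1 inf.absorb2 sup.absorb1)
    ultimately show ?thesis
      by simp
  qed
  then show ?thesis
    by blast
qed

text \<open>Each locally closed piece of X splits along \<open>lcs (c, top)\<close> and
  \<open>lcs (bot, c)\<close>, while \<open>lcs (c, top)\<close> splits along X and
  \<open>lcs (bot, c)\<close>. The part in \<open>lcs (bot, c)\<close> is trivial each time.\<close>

lemma Sb_complement_unique:
  assumes X: "X \<in> carrier Sb" and glb: "is_glb Sb {top} {X, lcs (bot, c)}"
    and lub: "is_lub Sb UNIV {X, lcs (bot, c)}"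
  shows "X = lcs (c, top)"
proof
  have sub: "is_sublocale S" if "S \<in> {X, lcs (bot, c)}" for S
    using that X is_sublocale_lcs is_sublocale_Sb by blast
  show "X \<subseteq> lcs (c, top)"
  proof (rule Sb_subsetI[OF X is_sublocale_lcs])
    fix p assume p: "lcs p \<subseteq> X"
    \<comment> \<open>The hypothesis \<open>glb\<close> speaks about members of \<open>Sb\<close>
      only; it applies because the intersection is again some \<open>lcs q\<close>.\<close>
    have *: "lcs p \<inter> lcs (bot, c) \<subseteq> {top}"
    proof -
      obtain q where q: "lcs p \<inter> lcs (bot, c) = lcs q"
        by (cases p) (metis lcs_Int)
      moreover have "{X, lcs (bot, c)} \<subseteq> carrier Sb"
        using X by (simp add: lcs_in_Sb)
      ultimately show ?thesis
        using glb p is_glb_Sb_iff[of "{X, lcs (bot, c)}" "{top}"]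
        by (metis Int_lower1 Int_lower2 insert_iff singletonD subset_trans)
    qed
    have "lcs p \<subseteq> sublocale_Join {lcs (c, top), lcs (bot, c)}"
      by (simp add: closed_Join_open)
    then have "lcs p = sublocale_Join ((\<inter>) (lcs p) ` {lcs (c, top), lcs (bot, c)})"
      by (intro lcs_eq_sublocale_Join_Int) (auto simp: is_sublocale_lcs)
    also have "\<dots> \<subseteq> lcs (c, top)"
      using * top_mem_sublocale[OF is_sublocale_lcs]
      by (intro sublocale_Join_subset is_sublocale_lcs) blast
    finally show "lcs p \<subseteq> lcs (c, top)" .
  qed
  have "lcs (c, top) \<subseteq> sublocale_Join {X, lcs (bot, c)}"
    using lub X by (simp add: is_lub_Sb_iff lcs_in_Sb)
  then have "lcs (c, top) = sublocale_Join ((\<inter>) (lcs (c, top)) ` {X, lcs (bot, c)})"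
    by (intro lcs_eq_sublocale_Join_Int sub)
  also have "\<dots> \<subseteq> X"
    using closed_Int_open[of c] top_mem_sublocale[OF is_sublocale_Sb[OF X]]
    by (intro sublocale_Join_subset is_sublocale_Sb[OF X]) auto
  finally show "lcs (c, top) \<subseteq> X" .
qed

section \<open>Extending a frame homomorphism\<close>

text \<open>Complements are determined by preserved joins and finite meets, so g is known on closed
  sublocales, and then on their binary meets with open ones.\<close>

lemma frame_hom_extension_lcs:
  fixes f :: "'a::frame \<Rightarrow> 'b::frame"
  assumes g: "frame_hom Sb Sb g" and open_eq: "\<And>a. g (open_sublocale a) = open_sublocale (f a)"
    and f: "f bot = bot" "f top = top"
  shows "g (lcs p) = lcs (map_prod f f p)"
proof -
  have Sb: "g X \<in> carrier Sb" if "X \<in> carrier Sb" for X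
    using g that by (auto simp: frame_hom_def)
  have lub: "is_lub Sb (g X) (g ` A)" if "A \<subseteq> carrier Sb" "is_lub Sb X A" for A X
    using g that by (auto simp: frame_hom_def)
  have glb: "is_glb Sb (g X) (g ` A)" if "A \<subseteq> carrier Sb" "finite A" "is_glb Sb X A" for A X
    using g that by (auto simp: frame_hom_def)
  have open_lcs: "g (lcs (bot, a)) = lcs (bot, f a)" for a
    using open_eq by (simp add: open_sublocale_eq_lcs)
  \<comment> \<open>The bounds are themselves open sublocales, those of \<open>bot\<close> and
    \<open>top\<close>, so their images are prescribed.\<close>
  have bot: "g {top} = {top}"
    using open_lcs[of bot] closed_Int_open[of "bot::'a"] closed_Int_open[of "bot::'b"]
    by (simp add: f lcs_bot_top)
  have top: "g UNIV = UNIV"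
    using open_lcs[of top] by (simp add: f lcs_bot_top)
  have closed_lcs: "g (lcs (a, top)) = lcs (f a, top)" for a
  proof (rule Sb_complement_unique)
    show "g (lcs (a, top)) \<in> carrier Sb"
      by (simp add: Sb lcs_in_Sb)
    have "is_glb Sb {top} {lcs (a, top), lcs (bot, a)}"
      using Int_lcs_is_glb[of "(a, top)" "(bot, a)"] by (simp add: closed_Int_open)
    from glb[OF _ _ this] show "is_glb Sb {top} {g (lcs (a, top)), lcs (bot, f a)}"
      by (simp add: bot open_lcs lcs_in_Sb)
    have "is_lub Sb UNIV {lcs (a, top), lcs (bot, a)}"
      by (simp add: is_lub_Sb_iff lcs_in_Sb closed_Join_open)
    from lub[OF _ this] show "is_lub Sb UNIV {g (lcs (a, top)), lcs (bot, f a)}"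
      by (simp add: top open_lcs lcs_in_Sb)
  qed
  obtain a b where p: "p = (a, b)"
    by fastforce
  have "is_glb Sb (lcs (a, b)) {lcs (a, top), lcs (bot, b)}"
    using Int_lcs_is_glb[of "(a, top)" "(bot, b)"] by (simp add: lcs_Int)
  from glb[OF _ _ this] have "is_glb Sb (g (lcs (a, b))) {lcs (f a, top), lcs (bot, f b)}"
    by (simp add: closed_lcs open_lcs lcs_in_Sb)
  moreover have "is_glb Sb (lcs (f a, f b)) {lcs (f a, top), lcs (bot, f b)}"
    using Int_lcs_is_glb[of "(f a, top)" "(bot, f b)"] by (simp add: lcs_Int)
  ultimately show ?thesis
    unfolding p by (auto simp: greatest_def Sb_def poset_on_def)
qed

text \<open>Defined for every set X, so that it can be applied to intersections that may lie outside
  \<open>Sb\<close>. Indexing by all pairs avoids choosing representatives.\<close>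

definition Sb_map :: "('a::frame \<Rightarrow> 'b::frame) \<Rightarrow> 'a set \<Rightarrow> 'b set"
  where "Sb_map f X = sublocale_Join (lcs ` map_prod f f ` {p. lcs p \<subseteq> X})"

lemma is_sublocale_Sb_map: "is_sublocale (Sb_map f X)"
  unfolding Sb_map_def by (rule is_sublocale_Join_lcs)

lemma lcs_subset_Sb_map: "lcs p \<subseteq> X \<Longrightarrow> lcs (map_prod f f p) \<subseteq> Sb_map f X"
  unfolding Sb_map_def by (intro subset_sublocale_Join) auto

lemma Sb_map_subsetI:
  assumes "is_sublocale Y" "\<And>p. lcs p \<subseteq> X \<Longrightarrow> lcs (map_prod f f p) \<subseteq> Y"
  shows "Sb_map f X \<subseteq> Y"
  unfolding Sb_map_def image_image
proof (rule sublocale_Join_subset[OF assms(1)])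
  fix S assume "S \<in> (\<lambda>p. lcs (map_prod f f p)) ` {p. lcs p \<subseteq> X}"
  then obtain p where "S = lcs (map_prod f f p)" "lcs p \<subseteq> X"
    by blast
  then show "S \<subseteq> Y"
    by (simp only: assms(2))
qed

lemma Sb_map_mono: "X \<subseteq> Y \<Longrightarrow> Sb_map f X \<subseteq> Sb_map f Y"
  by (intro Sb_map_subsetI is_sublocale_Sb_map lcs_subset_Sb_map) auto

lemma Sb_map_lcs:
  fixes f :: "'a::frame \<Rightarrow> 'b::frame"
  assumes "\<And>x y. f (inf x y) = inf (f x) (f y)" "\<And>x y. f (sup x y) = sup (f x) (f y)"
  shows "Sb_map f (lcs p) = lcs (map_prod f f p)"
  by (intro equalityI lcs_subset_Sb_map Sb_map_subsetI is_sublocale_lcs lcs_map_mono assms) auto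

text \<open>A locally closed sublocale below the join is itself a join of locally closed pieces,
  each inside one member of A; local exactness preserves exactly such joins.\<close>

lemma Sb_map_Join:
  fixes f :: "'a::frame \<Rightarrow> 'b::frame"
  assumes f: "\<And>x y. f (inf x y) = inf (f x) (f y)" "\<And>x y. f (sup x y) = sup (f x) (f y)"
    and exact: "locally_exact f" and A: "A \<subseteq> carrier Sb"
  shows "Sb_map f (sublocale_Join A) = sublocale_Join (Sb_map f ` A)"
proof
  have J: "is_sublocale (sublocale_Join (Sb_map f ` A))"
    by (rule is_sublocale_Join) (auto simp: is_sublocale_Sb_map)
  show "sublocale_Join (Sb_map f ` A) \<subseteq> Sb_map f (sublocale_Join A)"
    by (intro sublocale_Join_subset is_sublocale_Sb_map)
      (auto dest: Sb_map_mono[OF subset_sublocale_Join])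
  show "Sb_map f (sublocale_Join A) \<subseteq> sublocale_Join (Sb_map f ` A)"
  proof (rule Sb_map_subsetI[OF J])
    fix p assume p: "lcs p \<subseteq> sublocale_Join A"
    \<comment> \<open>These pieces cover \<open>lcs p\<close>: split it along A, then split each
      \<open>lcs p \<inter> X\<close> along the locally closed parts of X.\<close>
    define Q where "Q = {q. lcs q \<subseteq> lcs p \<and> (\<exists>X\<in>A. lcs q \<subseteq> X)}"
    have "lcs p = sublocale_Join ((\<inter>) (lcs p) ` A)"
      using A p by (intro lcs_eq_sublocale_Join_Int) (auto simp: is_sublocale_Sb)
    also have "\<dots> \<subseteq> sublocale_Join (lcs ` Q)"
    proof (intro sublocale_Join_subset is_sublocale_Join_lcs)
      fix S assume "S \<in> (\<inter>) (lcs p) ` A"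
      then obtain X where X: "X \<in> A" "S = lcs p \<inter> X"
        by blast
      let ?P = "{q. lcs q \<subseteq> X}"
      have "S \<subseteq> lcs p \<inter> sublocale_Join (lcs ` ?P)"
        using X A Sb_eq_sublocale_Join by blast
      also have "\<dots> \<subseteq> sublocale_Join ((\<inter>) (lcs p) ` lcs ` ?P)"
        by (rule lcs_Int_sublocale_Join) (auto simp: is_sublocale_lcs)
      also have "\<dots> \<subseteq> sublocale_Join (lcs ` Q)"
      proof (intro sublocale_Join_subset is_sublocale_Join_lcs)
        fix T assume "T \<in> (\<inter>) (lcs p) ` lcs ` ?P"
        then obtain q where q: "lcs q \<subseteq> X" "T = lcs p \<inter> lcs q"
          by blast
        moreover obtain r where "T = lcs r"
          using q(2) by (cases p, cases q) (metis lcs_Int)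
        ultimately have "r \<in> Q" "T = lcs r"
          using X(1) by (auto simp: Q_def)
        then show "T \<subseteq> sublocale_Join (lcs ` Q)"
          by (intro subset_sublocale_Join) auto
      qed
      finally show "S \<subseteq> sublocale_Join (lcs ` Q)" .
    qed
    finally have "lcs p = sublocale_Join (lcs ` Q)"
      by (intro equalityI sublocale_Join_subset is_sublocale_lcs) (auto simp: Q_def)
    then have "lcs (map_prod f f p) = sublocale_Join (lcs ` map_prod f f ` Q)"
      using exact locally_exact_iff[of f] f by blast
    also have "\<dots> \<subseteq> sublocale_Join (Sb_map f ` A)"
    proof (intro sublocale_Join_subset J)
      fix S assume "S \<in> lcs ` map_prod f f ` Q"
      then obtain q X where "S = lcs (map_prod f f q)" "X \<in> A" "lcs q \<subseteq> X"
        by (auto simp: Q_def)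
      then show "S \<subseteq> sublocale_Join (Sb_map f ` A)"
        using lcs_subset_Sb_map[of q X f] subset_sublocale_Join[of "Sb_map f X" "Sb_map f ` A"]
        by blast
    qed
    finally show "lcs (map_prod f f p) \<subseteq> sublocale_Join (Sb_map f ` A)" .
  qed
qed

text \<open>Two covers of \<open>lcs t\<close> have a common refinement by intersections, and f
  commutes with intersecting pairs because it preserves binary meets and joins.\<close>

lemma lcs_subset_Sb_map_finite:
  fixes f :: "'a::frame \<Rightarrow> 'b::frame"
  assumes f: "\<And>x y. f (inf x y) = inf (f x) (f y)" "\<And>x y. f (sup x y) = sup (f x) (f y)"
      "f bot = bot" "f top = top"
    and "finite A" "\<forall>X\<in>A. lcs t \<subseteq> Sb_map f X"
  shows "lcs t \<subseteq> Sb_map f (\<Inter>A)"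
  using assms(5,6)
proof induction
  case empty
  then show ?case
    \<comment> \<open>The empty intersection is represented by \<open>(bot, top)\<close>, which f
      maps to \<open>(bot, top)\<close>.\<close>
    using lcs_subset_Sb_map[of "(bot, top)" UNIV f] by (simp add: f lcs_bot_top top.extremum_unique)
next
  case (insert X A)
  let ?F = "\<lambda>X. lcs ` map_prod f f ` {p. lcs p \<subseteq> X}"
  let ?J = "Sb_map f (\<Inter>(insert X A))"
  have "lcs t = sublocale_Join ((\<inter>) (lcs t) ` ?F X)"
    using insert.prems by (intro lcs_eq_sublocale_Join_Int) (auto simp: Sb_map_def is_sublocale_lcs)
  also have "\<dots> \<subseteq> ?J"
  proof (intro sublocale_Join_subset is_sublocale_Sb_map)
    fix S assume "S \<in> (\<inter>) (lcs t) ` ?F X"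
    then obtain p where p: "lcs p \<subseteq> X" "S = lcs t \<inter> lcs (map_prod f f p)"
      unfolding image_image by (elim imageE CollectE) (rule that)
    have "S \<subseteq> lcs (map_prod f f p) \<inter> sublocale_Join (?F (\<Inter>A))"
      using p insert by (auto simp: Sb_map_def)
    also have "\<dots> \<subseteq> sublocale_Join ((\<inter>) (lcs (map_prod f f p)) ` ?F (\<Inter>A))"
      by (rule lcs_Int_sublocale_Join) (auto simp: is_sublocale_lcs)
    also have "\<dots> \<subseteq> ?J"
    proof (intro sublocale_Join_subset is_sublocale_Sb_map)
      fix T assume "T \<in> (\<inter>) (lcs (map_prod f f p)) ` ?F (\<Inter>A)"
      then obtain q where q: "lcs q \<subseteq> \<Inter>A" "T = lcs (map_prod f f p) \<inter> lcs (map_prod f f q)"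
        unfolding image_image by (elim imageE CollectE) (rule that)
      obtain a b c d where [simp]: "p = (a, b)" "q = (c, d)"
        by (cases p, cases q) blast
      have "T = lcs (map_prod f f (sup a c, inf b d))"
        using q by (simp add: lcs_Int f)
      moreover have "lcs (sup a c, inf b d) \<subseteq> \<Inter>(insert X A)"
        using p(1) q(1) by (auto simp flip: lcs_Int)
      ultimately show "T \<subseteq> ?J"
        using lcs_subset_Sb_map by metis
    qed
    finally show "S \<subseteq> ?J" .
  qed
  finally show ?case .
qed

lemma frame_hom_Sb_map:
  fixes f :: "'a::frame \<Rightarrow> 'b::frame"
  assumes f: "\<And>x y. f (inf x y) = inf (f x) (f y)" "\<And>x y. f (sup x y) = sup (f x) (f y)"
      "f bot = bot" "f top = top"
    and exact: "locally_exact f"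
  shows "frame_hom Sb Sb (Sb_map f)"
  unfolding frame_hom_def
proof (intro conjI allI impI)
  have Sb: "Sb_map f X \<in> carrier Sb" for X
    unfolding Sb_map_def by (rule sublocale_Join_lcs_in_Sb)
  then show "Sb_map f \<in> carrier Sb \<rightarrow> carrier Sb"
    by blast
  fix A :: "'a set set" and X assume A: "A \<subseteq> carrier Sb"
  have A': "Sb_map f ` A \<subseteq> carrier Sb"
    using Sb by blast
  show "is_lub Sb (Sb_map f X) (Sb_map f ` A)" if "is_lub Sb X A"
    using that Sb_map_Join[OF f(1,2) exact A] by (simp add: is_lub_Sb_iff A A')
  show "is_glb Sb (Sb_map f X) (Sb_map f ` A)" if "finite A" and glb: "is_glb Sb X A"
    unfolding is_glb_Sb_iff[OF A']
  proof (intro conjI allI impI Sb)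
    show "\<forall>Y\<in>Sb_map f ` A. Sb_map f X \<subseteq> Y"
      using glb A by (auto simp: is_glb_Sb_iff dest!: Sb_map_mono[of X _ f])
    fix t assume "\<forall>Y\<in>Sb_map f ` A. lcs t \<subseteq> Y"
    then have "lcs t \<subseteq> Sb_map f (\<Inter>A)"
      using lcs_subset_Sb_map_finite[of f A t] f \<open>finite A\<close> by blast
    \<comment> \<open>The meet X may be smaller than \<open>\<Inter>A\<close>, but it contains the
      same locally closed sublocales, and \<open>Sb_map\<close> sees nothing else.\<close>
    also have "\<dots> \<subseteq> Sb_map f X"
    proof (intro Sb_map_subsetI is_sublocale_Sb_map lcs_subset_Sb_map)
      show "lcs p \<subseteq> X" if "lcs p \<subseteq> \<Inter>A" for p
        using that glb unfolding is_glb_Sb_iff[OF A] by blast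
    qed
    finally show "lcs t \<subseteq> Sb_map f X" .
  qed
qed

theorem theorem6p5:
  fixes f :: "'a::frame \<Rightarrow> 'b::frame"
  assumes "frame_hom frame_order frame_order f"
  shows "(\<exists>g :: 'a set \<Rightarrow> 'b set. frame_hom Sb Sb g \<and>
            (\<forall>a. g (open_sublocale a) = open_sublocale (f a)))
         \<longleftrightarrow> locally_exact f"
proof -
  have Sup: "f (Sup A) = Sup (f ` A)" and top: "f top = top"
    and inf: "f (inf x y) = inf (f x) (f y)" for A x y
    using assms by (auto simp: frame_hom_frame_order)
  have bot: "f bot = bot" and sup: "f (sup x y) = sup (f x) (f y)" for x y
    using Sup[of "{}"] Sup[of "{x, y}"] by simp_all
  show ?thesis
  proof
    assume "\<exists>g :: 'a set \<Rightarrow> 'b set. frame_hom Sb Sb g \<and>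
      (\<forall>a. g (open_sublocale a) = open_sublocale (f a))"
    then obtain g :: "'a set \<Rightarrow> 'b set" where g: "frame_hom Sb Sb g"
      "\<And>a. g (open_sublocale a) = open_sublocale (f a)"
      by blast
    have g_lcs: "g (lcs p) = lcs (map_prod f f p)" for p
      using frame_hom_extension_lcs[OF g bot top] .
    \<comment> \<open>A join of sublocales is a least upper bound in \<open>Sb\<close>, hence
      preserved by g; this is the criterion of \<open>locally_exact_iff\<close>.\<close>
    have "lcs (map_prod f f m) = sublocale_Join (lcs ` map_prod f f ` A)"
      if m: "lcs m = sublocale_Join (lcs ` A)" for A m
    proof -
      have A: "lcs ` A \<subseteq> carrier Sb" "lcs ` map_prod f f ` A \<subseteq> carrier Sb"
        by (auto simp: lcs_in_Sb)
      then have "is_lub Sb (g (lcs m)) (g ` lcs ` A)"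
        using g(1) m unfolding frame_hom_def by (simp add: is_lub_Sb_iff)
      moreover have "g ` lcs ` A = lcs ` map_prod f f ` A"
        by (simp add: image_image g_lcs)
      ultimately show ?thesis
        using A(2) by (simp add: is_lub_Sb_iff g_lcs)
    qed
    then show "locally_exact f"
      using locally_exact_iff[OF inf sup] by blast
  next
    assume "locally_exact f"
    then have "frame_hom Sb Sb (Sb_map f)"
      by (rule frame_hom_Sb_map[OF inf sup bot top])
    moreover have "Sb_map f (open_sublocale a) = open_sublocale (f a)" for a
      by (simp add: open_sublocale_eq_lcs Sb_map_lcs[OF inf sup] bot)
    ultimately show "\<exists>g :: 'a set \<Rightarrow> 'b set. frame_hom Sb Sb g \<and>
      (\<forall>a. g (open_sublocale a) = open_sublocale (f a))"
      by blast
  qed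
qed

end
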